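(* Let $v$ be a vertex of a graph $G$. Then the list $M_A(G(v))$, $M_A(G(v,\ell))$, $M_A(G(v,\ell i))$, $M_A(G^{v}(v))$, $M_A(G^{v}(v,\ell))$, $M_A(G^{v}(v,\ell i))$ includes either two or three distinct matroids. Only one of these distinct matroids does not include $v$ as a coloop, and this matroid determines the others as follows. 1. If $v$ is a coloop of both $M_A(G(v))$ and $M_A(G(v,\ell))$ then $v$ is not a coloop of $M_A(G^{v}(v,\ell))$, $$M_A(G(v,\ell i))=(M_A(G^{v}(v,\ell))/v)\oplus U_{1,1}(\{v\})\quad\text{and}$$ $$M_A(G(v))=M_A(G(v,\ell))=M_A(G^{v}(v))=M_A(G^{v}(v,\ell i))=(M_A(G^{v}(v,\ell))-v)\oplus U_{1,1}(\{v\}).$$ Moreover, $M_A(G(v,\ell i))$ and $M_A(G^{v}(v,\ell))$ have the same nullity, say $\nu+1$; the nullity of $M_A(G(v))$ is $\nu$ and $$Z(M_A(G(v,\ell i)))\cap Z(M_A(G^{v}(v,\ell)))=Z(M_A(G(v))).$$ This case requires that $G^{v}-v$ have at least one looped vertex. 2. If $v$ is not a coloop of $M_A(G(v,\ell))$ then the assertions of case 1 hold, with the roles of $G$ and $G^{v}$ interchanged. That is: $M_A(G^{v}(v,\ell i))=(M_A(G(v,\ell))/v)\oplus U_{1,1}(\{v\})$; $M_A(G^{v}(v))=M_A(G^{v}(v,\ell))=M_A(G(v))=M_A(G(v,\ell i))=(M_A(G(v,\ell))-v)\oplus U_{1,1}(\{v\})$; $M_A(G^{v}(v,\ell i))$ and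 $M_A(G(v,\ell))$ have the same nullity, say $\nu+1$, the nullity of $M_A(G^{v}(v))$ is $\nu$, and $Z(M_A(G^{v}(v,\ell i)))\cap Z(M_A(G(v,\ell)))=Z(M_A(G^{v}(v)))$; and this case requires that $G-v$ have at least one looped vertex. 3. If $v$ is not a coloop of $M_A(G(v))$ then $$M_A(G^{v}(v))=M_A(G(v))\quad\text{and}$$ $$M_A(G(v,\ell))=M_A(G^{v}(v,\ell))=M_A(G(v,\ell i))=M_A(G^{v}(v,\ell i))=(M_A(G(v))-v)\oplus U_{1,1}(\{v\}).$$ Moreover, the nullity of $M_A(G(v))$ is $1$ more than the nullity of $M_A(G(v,\ell))$, and $$Z(M_A(G(v,\ell)))\subset Z(M_A(G(v))).$$
   Context: Graphs are finite and may have loops and parallel edges. $\mathcal{A}(G)$ is the symmetric $V(G)\times V(G)$ matrix over $GF(2)$ with $a_{vv}=1$ iff $v$ is looped and, for $v\ne w$, $a_{vw}=1$ iff $v,w$ are adjacent. The adjacency matroid $M_A(G)$ is the binary matroid on $V(G)$ whose circuits are the minimal nonempty $S\subseteq V(G)$ such that the columns of $\mathcal{A}(G)$ indexed by $S$ are linearly dependent over $GF(2)$. For a binary matroid $M$ on $V$, the cycle space $Z(M)$ is the subspace of the $GF(2)$-vector space $2^V$ (addition is symmetric difference) spanned by the circuits of $M$; $Z(M_A(G))$ is the nullspace of $\mathcal{A}(G)$, and the nullity of $M$ is $\dim Z(M)$. The local complement $G^{v}$ is the looped simple graph (no parallel edges, at most one loop per vertex) obtained from $G$ by toggling the loop status of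 every neighbor $w\neq v$ of $v$ and toggling the adjacency status of every pair of distinct neighbors of $v$ (both different from $v$); all other adjacencies and loop statuses, including the loop status of $v$, are unchanged, and parallel edges are replaced by single edges. For any graph $H$ with vertex $v$: $H(v)$ is obtained from $H$ by removing every loop at $v$; $H(v,\ell)$ is obtained from $H(v)$ by attaching a loop at $v$; $H(v,\ell i)$ is obtained from $H(v,\ell)$ by isolating $v$ (removing all non-loop edges incident on $v$). So $G^{v}(v,\ell)$ means $(G^v)(v,\ell)$, etc. $G-v$ is the full subgraph induced by $V(G)\setminus\{v\}$. For a matroid $M$ on $V$ and $v\in V$: $v$ is a coloop of $M$ if it belongs to no circuit; $M-v$ is the matroid on $V\setminus\{v\}$ whose circuits are the circuits of $M$ avoiding $v$; $M/v$ is the matroid on $V\setminus\{v\}$ whose circuits are the minimal nonempty $\gamma\subseteq V\setminus\{v\}$ such that $\gamma\cup\{v\}$ contains a circuit of $M$. $\oplus$ is the direct sum of matroids on disjoint ground sets, and $U_{1,1}(\{v\})$ is the matroid on $\{v\}$ in which $v$ is a coloop. *)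

theory Defs
  imports Complex_Main "HOL-Library.Multiset" "HOL-Library.Z2" "HOL-Library.Function_Algebras"
begin

section \<open>Graphs\<close>

text \<open>
  Graphs are undirected multigraphs. An edge is the set of its end-vertices: a two-element set, or
  a singleton \<open>{v}\<close> for a loop at \<open>v\<close>. Parallel edges are given by multiplicities.
\<close>

record 'a graph =
  verts :: "'a set"
  edges :: "'a set multiset"

definition graph :: "'a graph \<Rightarrow> bool" where
  "graph G \<longleftrightarrow> finite (verts G) \<and>
     (\<forall>e\<in>#edges G. e \<subseteq> verts G \<and> (card e = 1 \<or> card e = 2))"

definition looped :: "'a graph \<Rightarrow> 'a \<Rightarrow> bool" where
  "looped G v \<longleftrightarrow> {v} \<in># edges G"

definition adjacent :: "'a graph \<Rightarrow> 'a \<Rightarrow> 'a \<Rightarrow> bool" where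
  "adjacent G v w \<longleftrightarrow> v \<noteq> w \<and> {v, w} \<in># edges G"

definition local_complement :: "'a graph \<Rightarrow> 'a \<Rightarrow> 'a graph" where
  "local_complement G v =
     \<lparr>verts = verts G,
      edges = mset_set
        ({{w} | w. w \<in> verts G \<and> looped G w \<noteq> adjacent G v w} \<union>
         {{w, x} | w x. w \<in> verts G \<and> x \<in> verts G \<and> w \<noteq> x \<and>
            adjacent G w x \<noteq> (adjacent G v w \<and> adjacent G v x)})\<rparr>"

text \<open>The next three definitions are $H(v)$, $H(v,\ell)$ and $H(v,\ell i)$.\<close>

definition unloop :: "'a graph \<Rightarrow> 'a \<Rightarrow> 'a graph" where
  "unloop H v = H\<lparr>edges := filter_mset (\<lambda>e. e \<noteq> {v}) (edges H)\<rparr>"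

definition loop :: "'a graph \<Rightarrow> 'a \<Rightarrow> 'a graph" where
  "loop H v = H\<lparr>edges := add_mset {v} (edges (unloop H v))\<rparr>"

definition loop_isolate :: "'a graph \<Rightarrow> 'a \<Rightarrow> 'a graph" where
  "loop_isolate H v = H\<lparr>edges := filter_mset (\<lambda>e. v \<in> e \<longrightarrow> e = {v}) (edges (loop H v))\<rparr>"

definition delete_vertex :: "'a graph \<Rightarrow> 'a \<Rightarrow> 'a graph" where
  "delete_vertex G v =
     \<lparr>verts = verts G - {v}, edges = filter_mset (\<lambda>e. e \<subseteq> verts G - {v}) (edges G)\<rparr>"


section \<open>Matroids\<close>

record 'a matroid =
  ground :: "'a set"
  circuits :: "'a set set"

definition matroid :: "'a matroid \<Rightarrow> bool" where
  "matroid M \<longleftrightarrow>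
     finite (ground M) \<and>
     (\<forall>C\<in>circuits M. C \<noteq> {} \<and> C \<subseteq> ground M) \<and>
     (\<forall>C\<in>circuits M. \<forall>D\<in>circuits M. C \<subseteq> D \<longrightarrow> C = D) \<and>
     (\<forall>C\<in>circuits M. \<forall>D\<in>circuits M. \<forall>e\<in>C \<inter> D. C \<noteq> D \<longrightarrow>
        (\<exists>B\<in>circuits M. B \<subseteq> C \<union> D - {e}))"

definition minimal_nonempty_subsets :: "'a set \<Rightarrow> ('a set \<Rightarrow> bool) \<Rightarrow> 'a set set" where
  "minimal_nonempty_subsets V P =
     {S. S \<subseteq> V \<and> S \<noteq> {} \<and> P S \<and> (\<forall>T. T \<subset> S \<and> T \<noteq> {} \<longrightarrow> \<not> P T)}"

definition coloop :: "'a matroid \<Rightarrow> 'a \<Rightarrow> bool" where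
  "coloop M v \<longleftrightarrow> v \<in> ground M \<and> (\<forall>C\<in>circuits M. v \<notin> C)"

definition delete :: "'a matroid \<Rightarrow> 'a \<Rightarrow> 'a matroid" where
  "delete M v = \<lparr>ground = ground M - {v}, circuits = {C \<in> circuits M. v \<notin> C}\<rparr>"

text \<open>
  If \<open>{v}\<close> is a circuit, this makes every element of \<open>ground M - {v}\<close> a loop, which differs from
  the usual convention that contracting a loop deletes it.
\<close>

definition contract :: "'a matroid \<Rightarrow> 'a \<Rightarrow> 'a matroid" where
  "contract M v =
     \<lparr>ground = ground M - {v},
      circuits = minimal_nonempty_subsets (ground M - {v})
        (\<lambda>S. \<exists>C\<in>circuits M. C \<subseteq> S \<union> {v})\<rparr>"

text \<open>Meaningful for disjoint ground sets only.\<close>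

definition direct_sum :: "'a matroid \<Rightarrow> 'a matroid \<Rightarrow> 'a matroid" (infixl "\<oplus>" 65) where
  "M \<oplus> N = \<lparr>ground = ground M \<union> ground N, circuits = circuits M \<union> circuits N\<rparr>"

text \<open>$U_{1,1}(\{v\})$\<close>

definition U11 :: "'a \<Rightarrow> 'a matroid" where
  "U11 v = \<lparr>ground = {v}, circuits = {}\<rparr>"


section \<open>The cycle space\<close>

text \<open>
  A subset is identified with its characteristic vector over $GF(2)$ (the type \<open>bit\<close>), so that
  symmetric difference is pointwise addition.
\<close>

definition char_vec :: "'a set \<Rightarrow> 'a \<Rightarrow> bit" where
  "char_vec S = (\<lambda>x. if x \<in> S then 1 else 0)"

definition scale_bit :: "bit \<Rightarrow> ('a \<Rightarrow> bit) \<Rightarrow> 'a \<Rightarrow> bit" where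
  "scale_bit c f = (\<lambda>x. c * f x)"

global_interpretation gf2: vector_space scale_bit
  by unfold_locales (auto simp: scale_bit_def fun_eq_iff algebra_simps)

lemma char_vec_sym_diff: "char_vec ((S - T) \<union> (T - S)) = char_vec S + char_vec T"
  by (auto simp: char_vec_def fun_eq_iff)

definition cycle_space :: "'a matroid \<Rightarrow> ('a \<Rightarrow> bit) set" where
  "cycle_space M = gf2.span (char_vec ` circuits M)"

definition nullity :: "'a matroid \<Rightarrow> nat" where
  "nullity M = gf2.dim (cycle_space M)"


section \<open>The adjacency matroid\<close>

definition adj_matrix :: "'a graph \<Rightarrow> 'a \<Rightarrow> 'a \<Rightarrow> bit" where
  "adj_matrix G v w = (if (if v = w then looped G v else adjacent G v w) then 1 else 0)"

text \<open>
  The columns form an indexed family: equal columns with distinct indices are dependent. Hence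
  \<open>gf2.dependent\<close>, which applies to sets of vectors, is not the appropriate notion.
\<close>

definition columns_dependent :: "'a graph \<Rightarrow> 'a set \<Rightarrow> bool" where
  "columns_dependent G S \<longleftrightarrow>
     (\<exists>c :: 'a \<Rightarrow> bit. (\<exists>s\<in>S. c s \<noteq> 0) \<and>
        (\<forall>w\<in>verts G. (\<Sum>s\<in>S. c s * adj_matrix G w s) = 0))"

definition adjacency_matroid :: "'a graph \<Rightarrow> 'a matroid" where
  "adjacency_matroid G =
     \<lparr>ground = verts G,
      circuits = minimal_nonempty_subsets (verts G) (columns_dependent G)\<rparr>"


section \<open>Well-definedness\<close>

lemma graph_unloop: "graph H \<Longrightarrow> graph (unloop H v)"
  by (auto simp: graph_def unloop_def)

lemma graph_loop: "graph H \<Longrightarrow> v \<in> verts H \<Longrightarrow> graph (loop H v)"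
  by (auto simp: graph_def loop_def unloop_def)

lemma graph_loop_isolate: "graph H \<Longrightarrow> v \<in> verts H \<Longrightarrow> graph (loop_isolate H v)"
  by (auto simp: graph_def loop_isolate_def loop_def unloop_def)

lemma graph_delete_vertex: "graph G \<Longrightarrow> graph (delete_vertex G v)"
  by (auto simp: graph_def delete_vertex_def)

lemma graph_local_complement:
  assumes "graph G"
  shows "graph (local_complement G v)"
proof -
  let ?E = "{{w} | w. w \<in> verts G \<and> looped G w \<noteq> adjacent G v w} \<union>
         {{w, x} | w x. w \<in> verts G \<and> x \<in> verts G \<and> w \<noteq> x \<and>
            adjacent G w x \<noteq> (adjacent G v w \<and> adjacent G v x)}"
  have "?E \<subseteq> Pow (verts G)" by auto
  moreover have "finite (Pow (verts G))" using assms by (simp add: graph_def)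
  ultimately have "finite ?E" by (rule finite_subset)
  then show ?thesis
    using assms unfolding graph_def local_complement_def by (auto simp: card_insert_if)
qed

lemma minimal_nonempty_subset_exists:
  assumes "finite S" "S \<subseteq> V" "S \<noteq> {}" "P S"
  shows "\<exists>T\<in>minimal_nonempty_subsets V P. T \<subseteq> S"
  using assms
proof (induction S rule: finite_psubset_induct)
  case (psubset S)
  show ?case
  proof (cases "\<exists>T. T \<subset> S \<and> T \<noteq> {} \<and> P T")
    case True
    then obtain T where T: "T \<subset> S" "T \<noteq> {}" "P T" by blast
    then have "\<exists>U\<in>minimal_nonempty_subsets V P. U \<subseteq> T"
      using psubset.prems(1) by (intro psubset.IH) auto
    then show ?thesis using T(1) by auto
  next
    case False
    then have "S \<in> minimal_nonempty_subsets V P"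
      using psubset.prems unfolding minimal_nonempty_subsets_def by blast
    then show ?thesis by blast
  qed
qed

lemma adjacency_circuit_sum:
  assumes "finite (verts G)" "C \<in> circuits (adjacency_matroid G)" "w \<in> verts G"
  shows "(\<Sum>s\<in>C. adj_matrix G w s) = 0"
proof -
  have C: "C \<subseteq> verts G" "columns_dependent G C"
    and min: "\<And>T. T \<subset> C \<Longrightarrow> T \<noteq> {} \<Longrightarrow> \<not> columns_dependent G T"
    using assms(2) by (auto simp: adjacency_matroid_def minimal_nonempty_subsets_def)
  from C obtain c :: "'a \<Rightarrow> bit" where c: "\<exists>s\<in>C. c s \<noteq> 0"
    and z: "\<And>w. w \<in> verts G \<Longrightarrow> (\<Sum>s\<in>C. c s * adj_matrix G w s) = 0"
    by (auto simp: columns_dependent_def)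
  let ?T = "{s \<in> C. c s \<noteq> 0}"
  have fin: "finite C" using C(1) assms(1) finite_subset by blast
  have eq: "(\<Sum>s\<in>?T. c s * adj_matrix G w s) = (\<Sum>s\<in>C. c s * adj_matrix G w s)" for w
    by (rule sum.mono_neutral_left) (use fin in auto)
  have "columns_dependent G ?T"
    unfolding columns_dependent_def
  proof (intro exI[of _ c] conjI ballI)
    show "\<exists>s\<in>?T. c s \<noteq> 0" using c by blast
  qed (simp only: eq z)
  with min[of ?T] c have "?T = C" by blast
  then have "c s \<noteq> 0" if "s \<in> C" for s using that by blast
  then have "c s = 1" if "s \<in> C" for s using that by (cases "c s") auto
  then have "(\<Sum>s\<in>C. adj_matrix G w s) = (\<Sum>s\<in>C. c s * adj_matrix G w s)"
    by (intro sum.cong refl) (simp only: mult_1_left)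
  then show ?thesis by (simp only: z[OF assms(3)])
qed

lemma matroid_adjacency_matroid:
  assumes "graph G"
  shows "matroid (adjacency_matroid G)"
proof -
  let ?M = "adjacency_matroid G"
  have fin: "finite (verts G)" using assms by (simp add: graph_def)
  have sub: "C \<noteq> {} \<and> C \<subseteq> verts G" if "C \<in> circuits ?M" for C
    using that by (auto simp: adjacency_matroid_def minimal_nonempty_subsets_def)
  have anti: "C = D" if "C \<in> circuits ?M" "D \<in> circuits ?M" "C \<subseteq> D" for C D
    using that unfolding adjacency_matroid_def minimal_nonempty_subsets_def
    by (simp add: psubset_eq) blast
  have elim: "\<exists>B\<in>circuits ?M. B \<subseteq> C \<union> D - {e}"
    if C: "C \<in> circuits ?M" and D: "D \<in> circuits ?M" and e: "e \<in> C \<inter> D" and ne: "C \<noteq> D" for C D e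
  proof -
    let ?S = "(C - D) \<union> (D - C)"
    have f: "finite C" "finite D" using sub[OF C] sub[OF D] fin finite_subset by blast+
    have sum0: "(\<Sum>s\<in>?S. adj_matrix G w s) = 0" if w: "w \<in> verts G" for w
    proof -
      let ?f = "adj_matrix G w"
      have "sum ?f ?S = sum ?f (C - D) + sum ?f (D - C)"
        using f by (intro sum.union_disjoint) auto
      moreover have "sum ?f C = sum ?f (C \<inter> D) + sum ?f (C - D)"
        using f(1) by (rule sum.Int_Diff)
      moreover have "sum ?f D = sum ?f (D \<inter> C) + sum ?f (D - C)"
        using f(2) by (rule sum.Int_Diff)
      moreover have "sum ?f C = 0" "sum ?f D = 0"
        using adjacency_circuit_sum[OF fin C w] adjacency_circuit_sum[OF fin D w] .
      ultimately show ?thesis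
        by (cases "sum ?f (C \<inter> D)"; cases "sum ?f (C - D)"; cases "sum ?f (D - C)")
          (simp_all add: Int_commute)
    qed
    have S: "?S \<noteq> {}" "?S \<subseteq> verts G" using ne sub[OF C] sub[OF D] by auto
    then have "columns_dependent G ?S"
      unfolding columns_dependent_def using sum0
      by (intro exI[of _ "\<lambda>_. 1"]) (simp only: mult_1_left, blast intro: one_neq_zero)
    then have "\<exists>B\<in>circuits ?M. B \<subseteq> ?S"
      using minimal_nonempty_subset_exists[of ?S "verts G" "columns_dependent G"] S f
      by (simp add: adjacency_matroid_def)
    then show ?thesis using e by blast
  qed
  have "ground ?M = verts G" by (simp add: adjacency_matroid_def)
  then show ?thesis unfolding matroid_def using fin sub anti elim by auto
qed

end

theory Submission
  imports Defs
begin

text \<open>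
  An adjacency matroid is determined by the null space of its matrix, so the theorem is a statement
  about six subspaces of $GF(2)^V$. Write \<open>b\<close> for the row of \<open>v\<close> and \<open>A\<close> for the adjacency matrix
  of $G-v$, both restricted to $W = V \setminus \{v\}$, and split a vector as $(t, x)$, where
  \<open>t\<close> is its entry at \<open>v\<close>. Local complementation keeps \<open>b\<close> and replaces \<open>A\<close> by $A + bb^T$. Hence
  the null spaces are given by these equations:

  \<^item> for $G(v)$ and for $G^v(v)$: $b \cdot x = 0$ and $Ax = tb$;
  \<^item> for $G(v,\ell)$: $t = b \cdot x$ and $Ax = tb$; for $G^v(v,\ell i)$: $t = 0$ and
    $Ax = (b \cdot x) b$;
  \<^item> for $G^v(v,\ell)$: $t = b \cdot x$ and $Ax = 0$; for $G(v,\ell i)$: $t = 0$ and $Ax = 0$.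

  So each of the two isolated variants is obtained from the looped variant of the other graph by
  setting the entry at \<open>v\<close> to zero, and the three spaces for $G(v)$, $G(v,\ell)$, $G^v(v,\ell)$
  contain the same vectors with $t = 0$; call this common part \<open>H\<close>. The element \<open>v\<close> is a coloop
  precisely when all vectors in the null space have $t = 0$. A vector with $t = 1$ exists

  \<^item> in the space of $G(v)$ if $Ax = b$ has a solution with $b \cdot x = 0$,
  \<^item> in the space of $G(v,\ell)$ if $Ax = b$ has a solution with $b \cdot x = 1$,
  \<^item> in the space of $G^v(v,\ell)$ if $Ax = 0$ has a solution with $b \cdot x = 1$.

  Exactly one of these happens. By symmetry of \<open>A\<close>, any solutions of $Ax = b$ and $Ay = 0$ satisfy
  $b \cdot y = x^T A y = 0$, and two solutions of $Ax = b$ have the same product with \<open>b\<close>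
  (\<open>at_most_one_noncoloop\<close>). Conversely, if $Ay = 0$ implies $b \cdot y = 0$, then $Ax = b$ is
  solvable by the Fredholm alternative (\<open>exists_noncoloop_vector\<close>). The one exceptional space
  contains \<open>H\<close> as a hyperplane, and the other two are equal to \<open>H\<close>.

  What remains holds for every binary matroid in which \<open>v\<close> is not a coloop: the vectors with
  $t = 0$ describe the deletion of \<open>v\<close> with \<open>v\<close> put back as a coloop (\<open>noncoloop_matroid\<close>), and,
  unless \<open>v\<close> is a loop, the vectors with their entry at \<open>v\<close> set to zero describe the contraction
  (\<open>noncoloop_matroid_contract\<close>). A looped vertex is needed in the first two cases because
  $x^T A x = 0$ for a symmetric \<open>A\<close> with zero diagonal, while a vector of the looped graph with
  $t = 1$ gives $x^T A x = b \cdot x = 1$ (\<open>looped_vertex_if_noncoloop\<close>); this applies to $G^v$ and its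
  own matrix as well as to $G$.
\<close>

section \<open>Vectors and subsets over GF(2)\<close>

(* The linear algebra below treats sums and products of bits as ring operations; these two simp
   rules would turn them into boolean expressions, out of reach of the lemmas on sums. *)
declare add_bit_eq_xor [simp del] mult_bit_eq_and [simp del]

lemma bit_neq_zero: "(x::bit) \<noteq> 0 \<longleftrightarrow> x = 1" by (cases x) auto

lemma bit_add_eq_0: "(x::bit) + y = 0 \<longleftrightarrow> x = y" by (cases x; cases y) auto

lemma bit_add_self [simp]: "(x::bit) + x = 0"
  by (cases x) auto

definition supported_on :: "'a set \<Rightarrow> ('a \<Rightarrow> bit) set" where
  "supported_on V = {f. \<forall>x. x \<notin> V \<longrightarrow> f x = 0}"

definition support :: "('a \<Rightarrow> bit) \<Rightarrow> 'a set" where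
  "support f = {x. f x \<noteq> 0}"

lemma char_vec_support [simp]: "char_vec (support f) = f"
  by (auto simp: char_vec_def support_def fun_eq_iff bit_neq_zero)

lemma support_char_vec [simp]: "support (char_vec S) = S"
  by (auto simp: char_vec_def support_def)

lemma support_empty_iff [simp]: "support f = {} \<longleftrightarrow> f = 0"
  by (auto simp: support_def fun_eq_iff)

lemma support_subset_iff: "support f \<subseteq> V \<longleftrightarrow> f \<in> supported_on V"
  by (auto simp: support_def supported_on_def)

lemma in_support_iff: "x \<in> support f \<longleftrightarrow> f x \<noteq> 0"
  by (simp add: support_def)

lemma finite_supported_on:
  assumes "finite V"
  shows "finite (supported_on V)"
proof -
  have "supported_on V \<subseteq> char_vec ` Pow V"
  proof
    fix f :: "'a \<Rightarrow> bit" assume "f \<in> supported_on V"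
    then have "char_vec (support f) \<in> char_vec ` Pow V"
      by (intro imageI) (simp add: support_subset_iff)
    then show "f \<in> char_vec ` Pow V" by simp
  qed
  then show ?thesis using assms finite_subset by blast
qed

section \<open>The binary matroid of a space of vectors\<close>

text \<open>
  When \<open>Z\<close> is a subspace supported on the finite set \<open>V\<close>, this is the matroid with cycle space \<open>Z\<close>.
\<close>
definition binary_matroid :: "'a set \<Rightarrow> ('a \<Rightarrow> bit) set \<Rightarrow> 'a matroid" where
  "binary_matroid V Z =
     \<lparr>ground = V, circuits = minimal_nonempty_subsets V (\<lambda>S. char_vec S \<in> Z)\<rparr>"

text \<open>
  The minimal sets with a property depend only on the upward closure of the property. This makes
  it possible to replace linear dependence by membership in the null space, and to replace a
  condition on circuits by one on cycles.
\<close>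
lemma minimal_nonempty_subsets_cong:
  assumes "\<And>S. S \<subseteq> V \<Longrightarrow> S \<noteq> {} \<Longrightarrow> P S \<Longrightarrow> \<exists>T\<subseteq>S. T \<noteq> {} \<and> Q T"
    and "\<And>S. S \<subseteq> V \<Longrightarrow> S \<noteq> {} \<Longrightarrow> Q S \<Longrightarrow> \<exists>T\<subseteq>S. T \<noteq> {} \<and> P T"
  shows "minimal_nonempty_subsets V P = minimal_nonempty_subsets V Q"
proof -
  have *: "S \<in> minimal_nonempty_subsets V Q"
    if S: "S \<in> minimal_nonempty_subsets V P"
      and PQ: "\<And>S. S \<subseteq> V \<Longrightarrow> S \<noteq> {} \<Longrightarrow> P S \<Longrightarrow> \<exists>T\<subseteq>S. T \<noteq> {} \<and> Q T"
      and QP: "\<And>S. S \<subseteq> V \<Longrightarrow> S \<noteq> {} \<Longrightarrow> Q S \<Longrightarrow> \<exists>T\<subseteq>S. T \<noteq> {} \<and> P T"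
    for P Q :: "'a set \<Rightarrow> bool" and S
  proof -
    have S': "S \<subseteq> V" "S \<noteq> {}" "P S" and min: "\<And>T. T \<subset> S \<Longrightarrow> T \<noteq> {} \<Longrightarrow> \<not> P T"
      using S by (auto simp: minimal_nonempty_subsets_def)
    have minQ: "\<not> Q T" if "T \<subset> S" "T \<noteq> {}" for T
    proof
      assume "Q T"
      with QP[of T] that S' obtain U where "U \<subseteq> T" "U \<noteq> {}" "P U" by blast
      with min[of U] that show False by blast
    qed
    obtain T where "T \<subseteq> S" "T \<noteq> {}" "Q T" using PQ[OF S'] by blast
    with minQ have "Q S" by blast
    with S' minQ show ?thesis by (auto simp: minimal_nonempty_subsets_def)
  qed
  show ?thesis using *[of _ P Q] *[of _ Q P] assms by blast
qed

lemma exists_circuit_below: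
  assumes "finite V" "Z \<subseteq> supported_on V" "f \<in> Z" "f \<noteq> 0"
  shows "\<exists>C\<in>circuits (binary_matroid V Z). C \<subseteq> support f"
proof -
  have sub: "support f \<subseteq> V" using assms(2,3) by (auto simp: support_subset_iff)
  then have fin: "finite (support f)" using assms(1) finite_subset by blast
  show ?thesis
    unfolding binary_matroid_def matroid.simps
    using minimal_nonempty_subset_exists[OF fin sub] assms(3,4) by simp
qed

lemma circuits_binary_matroidD:
  assumes "C \<in> circuits (binary_matroid V Z)"
  shows "C \<subseteq> V" "C \<noteq> {}" "char_vec C \<in> Z"
  using assms by (auto simp: binary_matroid_def minimal_nonempty_subsets_def)

text \<open>
  Every vector of \<open>Z\<close> is a sum of circuits: as long as it is not zero, its support contains a
  circuit, and adding that circuit makes the support smaller.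
\<close>
lemma cycle_space_binary_matroid:
  assumes "finite V" "gf2.subspace Z" "Z \<subseteq> supported_on V"
  shows "cycle_space (binary_matroid V Z) = Z"
proof
  let ?M = "binary_matroid V Z"
  show "cycle_space ?M \<subseteq> Z"
    unfolding cycle_space_def using assms(2) circuits_binary_matroidD(3)
    by (intro gf2.span_minimal) auto
  have "f \<in> cycle_space ?M" if "finite S" "f \<in> Z" "support f = S" for f S
    using that
  proof (induction S arbitrary: f rule: finite_psubset_induct)
    case (psubset S)
    show ?case
    proof (cases "f = 0")
      case True
      then show ?thesis using gf2.span_zero by (simp only: cycle_space_def)
    next
      case False
      then obtain C where C: "C \<in> circuits ?M" "C \<subseteq> S"
        using exists_circuit_below[OF assms(1,3) psubset.prems(1)] psubset.prems(2) by blast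
      note CD = circuits_binary_matroidD[OF C(1)]
      have span: "char_vec C \<in> cycle_space ?M"
        using C(1) by (simp add: cycle_space_def gf2.span_base)
      have fC: "f x \<noteq> 0" if "x \<in> C" for x
        using that C(2) psubset.prems(2) in_support_iff by fastforce
      have "f + char_vec C \<in> Z" using gf2.subspace_add assms(2) psubset.prems(1) CD(3) by blast
      moreover have supp: "support (f + char_vec C) = S - C"
        using fC psubset.prems(2) by (auto simp: support_def char_vec_def bit_neq_zero)
      ultimately have "f + char_vec C \<in> cycle_space ?M"
        using C(2) CD(2) by (intro psubset.IH[OF _ _ supp]) (blast, assumption)
      then have "(f + char_vec C) - char_vec C \<in> cycle_space ?M"
        unfolding cycle_space_def using span gf2.span_diff cycle_space_def by metis
      then show ?thesis by simp
    qed
  qed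
  moreover have "finite (support f)" if "f \<in> Z" for f
  proof -
    have "support f \<subseteq> V" using that assms(3) by (auto simp: support_subset_iff)
    then show ?thesis using assms(1) finite_subset by blast
  qed
  ultimately show "Z \<subseteq> cycle_space ?M" by blast
qed

lemma coloop_binary_matroid_iff:
  assumes "finite V" "gf2.subspace Z" "Z \<subseteq> supported_on V" "v \<in> V"
  shows "coloop (binary_matroid V Z) v \<longleftrightarrow> (\<forall>f\<in>Z. f v = 0)"
proof
  assume "coloop (binary_matroid V Z) v"
  then have "char_vec C v = 0" if "C \<in> circuits (binary_matroid V Z)" for C
    using that by (simp add: coloop_def char_vec_def)
  moreover have "gf2.subspace {f :: 'a \<Rightarrow> bit. f v = 0}"
    by (auto simp: gf2.subspace_def scale_bit_def)
  ultimately have "cycle_space (binary_matroid V Z) \<subseteq> {f. f v = 0}"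
    unfolding cycle_space_def by (intro gf2.span_minimal) auto
  then show "\<forall>f\<in>Z. f v = 0" using cycle_space_binary_matroid[OF assms(1-3)] by auto
next
  assume *: "\<forall>f\<in>Z. f v = 0"
  have "v \<notin> C" if "C \<in> circuits (binary_matroid V Z)" for C
    using * circuits_binary_matroidD(3)[OF that] by (force simp: char_vec_def)
  then show "coloop (binary_matroid V Z) v"
    using assms(4) by (simp add: coloop_def binary_matroid_def)
qed

text \<open>
  Adding \<open>v\<close> as a coloop after removing it restores the ground set without changing the circuits,
  so a deletion or contraction is again given by a space of vectors on \<open>V\<close>.
\<close>
lemma delete_binary_matroid:
  assumes "v \<in> V"
  shows "delete (binary_matroid V Z) v \<oplus> U11 v = binary_matroid V {f \<in> Z. f v = 0}"
  using assms
  by (auto simp: delete_def binary_matroid_def direct_sum_def U11_def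
      minimal_nonempty_subsets_def char_vec_def)

abbreviation clear :: "'a \<Rightarrow> ('a \<Rightarrow> bit) \<Rightarrow> 'a \<Rightarrow> bit" where
  "clear v f \<equiv> f(v := 0)"

text \<open>
  If \<open>{v}\<close> were a circuit, then every singleton of \<open>V - {v}\<close> would be a circuit of the contraction,
  whatever \<open>Z\<close> is. Otherwise a circuit inside \<open>S \<union> {v}\<close> has a nonempty part in \<open>S\<close>, and this part
  belongs to \<open>clear v ` Z\<close>.
\<close>
lemma contract_binary_matroid:
  assumes V: "finite V" "Z \<subseteq> supported_on V" "v \<in> V" and nl: "char_vec {v} \<notin> Z"
  shows "contract (binary_matroid V Z) v \<oplus> U11 v = binary_matroid V (clear v ` Z)"
proof -
  have "minimal_nonempty_subsets (V - {v})
      (\<lambda>S. \<exists>C\<in>circuits (binary_matroid V Z). C \<subseteq> S \<union> {v}) =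
    minimal_nonempty_subsets (V - {v}) (\<lambda>S. char_vec S \<in> clear v ` Z)"
  proof (rule minimal_nonempty_subsets_cong)
    fix S assume "\<exists>C\<in>circuits (binary_matroid V Z). C \<subseteq> S \<union> {v}"
    then obtain C where C: "C \<in> circuits (binary_matroid V Z)" "C \<subseteq> S \<union> {v}" by blast
    note CD = circuits_binary_matroidD[OF C(1)]
    have "C \<noteq> {v}" using CD(3) nl by blast
    then have "C - {v} \<noteq> {}" using CD(2) by blast
    moreover have "char_vec (C - {v}) = clear v (char_vec C)"
      by (auto simp: char_vec_def fun_eq_iff)
    ultimately show "\<exists>T\<subseteq>S. T \<noteq> {} \<and> char_vec T \<in> clear v ` Z"
      using C(2) CD(3) by (intro exI[of _ "C - {v}"]) auto
  next
    fix S assume S: "S \<noteq> {}" "char_vec S \<in> clear v ` Z"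
    then obtain f where f: "f \<in> Z" "char_vec S = clear v f" by blast
    have eq: "f x = char_vec S x" if "x \<noteq> v" for x
      using fun_cong[OF f(2), of x] that by simp
    have "support f \<subseteq> S \<union> {v}"
    proof
      fix x assume "x \<in> support f"
      then show "x \<in> S \<union> {v}"
        using eq[of x] by (cases "x = v") (auto simp: support_def char_vec_def split: if_splits)
    qed
    moreover have "f \<noteq> 0"
    proof
      assume "f = 0"
      with f(2) have "char_vec S = 0" by (simp add: fun_eq_iff)
      with S(1) show False using support_char_vec support_empty_iff by metis
    qed
    ultimately have "\<exists>C\<in>circuits (binary_matroid V Z). C \<subseteq> S \<union> {v}"
      using exists_circuit_below[OF V(1,2) f(1)] by blast
    then show "\<exists>T\<subseteq>S. T \<noteq> {} \<and> (\<exists>C\<in>circuits (binary_matroid V Z). C \<subseteq> T \<union> {v})"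
      using S(1) by blast
  qed
  also have "\<dots> = minimal_nonempty_subsets V (\<lambda>S. char_vec S \<in> clear v ` Z)"
  proof -
    have "v \<notin> S" if "char_vec S \<in> clear v ` Z" for S
      using that by (auto simp: char_vec_def dest: fun_cong[of _ _ v])
    then show ?thesis by (auto simp: minimal_nonempty_subsets_def)
  qed
  finally show ?thesis using V(3)
    by (auto simp: contract_def binary_matroid_def direct_sum_def U11_def)
qed

text \<open>
  Adding \<open>g\<close> to a basis of \<open>H\<close> gives a basis of \<open>Z\<close>. The space of all functions may have infinite
  dimension, so it is the finiteness of \<open>Z\<close> that makes these bases finite.
\<close>
lemma dim_hyperplane:
  assumes "finite Z" "gf2.subspace Z" "gf2.subspace H" "H \<subseteq> Z" "g \<in> Z" "g \<notin> H"
    and "\<And>f. f \<in> Z \<Longrightarrow> f \<notin> H \<Longrightarrow> f - g \<in> H"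
  shows "gf2.dim Z = gf2.dim H + 1"
proof -
  obtain B where B: "B \<subseteq> H" "gf2.independent B" "H \<subseteq> gf2.span B" "card B = gf2.dim H"
    by (rule gf2.basis_exists)
  have spB: "gf2.span B = H"
    using gf2.span_minimal[OF B(1) assms(3)] B(3) by (rule subset_antisym)
  have "finite B" using B(1) assms(1,4) by (meson finite_subset)
  have "g \<notin> B" using B(1) assms(6) by blast
  have indep: "gf2.independent (insert g B)"
    using B(2) assms(6) gf2.independent_insert[of g B] unfolding spB by simp
  have "gf2.span (insert g B) = Z"
  proof
    show "gf2.span (insert g B) \<subseteq> Z"
      using B(1) assms(2,4,5) by (intro gf2.span_minimal) auto
    show "Z \<subseteq> gf2.span (insert g B)"
    proof
      fix f assume "f \<in> Z"
      have H: "H \<subseteq> gf2.span (insert g B)" using gf2.span_mono[of B "insert g B"] spB by auto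
      have g: "g \<in> gf2.span (insert g B)" by (simp add: gf2.span_base)
      show "f \<in> gf2.span (insert g B)"
      proof (cases "f \<in> H")
        case False
        then have "f - g \<in> gf2.span (insert g B)" using assms(7) \<open>f \<in> Z\<close> H by blast
        then have "(f - g) + g \<in> gf2.span (insert g B)" using g by (rule gf2.span_add)
        then show ?thesis by (simp only: diff_add_cancel)
      qed (use H in blast)
    qed
  qed
  also have "Z = gf2.span Z" using assms(2) gf2.span_eq_iff[of Z] by metis
  finally have "gf2.dim Z = card (insert g B)" using indep by (rule gf2.dim_eq_card)
  with \<open>finite B\<close> \<open>g \<notin> B\<close> B(4) show ?thesis by simp
qed

lemma noncoloop_matroid:
  assumes V: "finite V" "v \<in> V" and L: "gf2.subspace L" "L \<subseteq> supported_on V"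
    and g: "g \<in> L" "g v \<noteq> 0"
  defines "H \<equiv> {f \<in> L. f v = 0}"
  shows "\<not> coloop (binary_matroid V L) v" "coloop (binary_matroid V H) v"
    "binary_matroid V H = delete (binary_matroid V L) v \<oplus> U11 v"
    "nullity (binary_matroid V L) = nullity (binary_matroid V H) + 1"
    "cycle_space (binary_matroid V H) \<subset> cycle_space (binary_matroid V L)"
proof -
  have H: "gf2.subspace H" "H \<subseteq> supported_on V"
    using L by (auto simp: H_def gf2.subspace_def scale_bit_def)
  show "\<not> coloop (binary_matroid V L) v" "coloop (binary_matroid V H) v"
    using coloop_binary_matroid_iff[OF V(1) _ _ V(2)] L H g by (auto simp: H_def)
  show "binary_matroid V H = delete (binary_matroid V L) v \<oplus> U11 v"
    using delete_binary_matroid[OF V(2), of L] by (simp add: H_def)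
  show "cycle_space (binary_matroid V H) \<subset> cycle_space (binary_matroid V L)"
    unfolding cycle_space_binary_matroid[OF V(1) L] cycle_space_binary_matroid[OF V(1) H]
    using g unfolding H_def by blast
  have "finite L" using finite_supported_on[OF V(1)] L(2) by (rule rev_finite_subset)
  moreover have "f - g \<in> H" if "f \<in> L" "f \<notin> H" for f
    using that g gf2.subspace_diff[OF L(1)] by (simp add: H_def bit_neq_zero)
  ultimately show "nullity (binary_matroid V L) = nullity (binary_matroid V H) + 1"
    unfolding nullity_def cycle_space_binary_matroid[OF V(1) L]
      cycle_space_binary_matroid[OF V(1) H]
    using L(1) H(1) g by (intro dim_hyperplane[of _ _ g]) (auto simp: H_def)
qed

text \<open>
  Both \<open>I\<close> and \<open>L\<close> contain \<open>H\<close> as a hyperplane: \<open>g\<close> spans \<open>L\<close> over \<open>H\<close>, and \<open>clear v g\<close> spans \<open>I\<close>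
  over \<open>H\<close>. The vector \<open>clear v g\<close> is not in \<open>H\<close>, since otherwise its difference from \<open>g\<close>, which is
  \<open>char_vec {v}\<close>, would be in \<open>L\<close>.
\<close>
lemma noncoloop_matroid_contract:
  assumes V: "finite V" "v \<in> V" and L: "gf2.subspace L" "L \<subseteq> supported_on V"
    and g: "g \<in> L" "g v \<noteq> 0" and nl: "char_vec {v} \<notin> L"
  defines "H \<equiv> {f \<in> L. f v = 0}" and "I \<equiv> clear v ` L"
  shows "coloop (binary_matroid V I) v"
    "binary_matroid V I = contract (binary_matroid V L) v \<oplus> U11 v"
    "nullity (binary_matroid V I) = nullity (binary_matroid V H) + 1"
    "cycle_space (binary_matroid V I) \<inter> cycle_space (binary_matroid V L) =
      cycle_space (binary_matroid V H)"
proof -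
  have H: "gf2.subspace H" "H \<subseteq> supported_on V"
    using L by (auto simp: H_def gf2.subspace_def scale_bit_def)
  have I_sub: "gf2.subspace I"
  proof (rule gf2.subspaceI)
    have "0 = clear v (0 :: 'a \<Rightarrow> bit)" by (simp add: fun_eq_iff)
    then show "0 \<in> I" unfolding I_def using gf2.subspace_0[OF L(1)] by (rule image_eqI)
  next
    fix x y assume "x \<in> I" "y \<in> I"
    then obtain x' y' where xy: "x' \<in> L" "y' \<in> L" "x = clear v x'" "y = clear v y'"
      by (auto simp: I_def)
    then have "x + y = clear v (x' + y')" by (simp add: fun_eq_iff)
    then show "x + y \<in> I" unfolding I_def using gf2.subspace_add[OF L(1) xy(1,2)] by (rule image_eqI)
  next
    fix c x assume "x \<in> I"
    then obtain x' where x: "x' \<in> L" "x = clear v x'" by (auto simp: I_def)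
    then have "scale_bit c x = clear v (scale_bit c x')" by (simp add: fun_eq_iff scale_bit_def)
    then show "scale_bit c x \<in> I"
      unfolding I_def using gf2.subspace_scale[OF L(1) x(1)] by (rule image_eqI)
  qed
  have I: "gf2.subspace I" "I \<subseteq> supported_on V"
    using I_sub L(2) by (auto simp: I_def supported_on_def)
  note cycle_space_eq = cycle_space_binary_matroid[OF V(1) L] cycle_space_binary_matroid[OF V(1) H]
    cycle_space_binary_matroid[OF V(1) I]
  show "coloop (binary_matroid V I) v"
    using coloop_binary_matroid_iff[OF V(1) I V(2)] by (auto simp: I_def)
  show "binary_matroid V I = contract (binary_matroid V L) v \<oplus> U11 v"
    using contract_binary_matroid[OF V(1) L(2) V(2) nl] by (simp add: I_def)
  have HI: "H \<subseteq> I"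
  proof
    fix f assume "f \<in> H"
    then have "f = clear v f" "f \<in> L" by (auto simp: H_def fun_eq_iff)
    then show "f \<in> I" unfolding I_def by (rule image_eqI)
  qed
  then show "cycle_space (binary_matroid V I) \<inter> cycle_space (binary_matroid V L) =
      cycle_space (binary_matroid V H)"
    unfolding cycle_space_eq by (auto simp: H_def I_def)
  have "clear v g \<notin> H"
  proof
    assume "clear v g \<in> H"
    then have "g - clear v g \<in> L" using g(1) gf2.subspace_diff[OF L(1)] by (simp add: H_def)
    moreover have "g - clear v g = char_vec {v}"
      using g(2) by (auto simp: fun_eq_iff char_vec_def bit_neq_zero)
    ultimately show False using nl by simp
  qed
  moreover have "f - clear v g \<in> H" if f: "f \<in> I" "f \<notin> H" for f
  proof -
    obtain f' where f': "f' \<in> L" "f = clear v f'" using f(1) by (auto simp: I_def)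
    have "f' v \<noteq> 0"
    proof
      assume "f' v = 0"
      then have "clear v f' = f'" by (simp add: fun_eq_iff)
      with \<open>f' v = 0\<close> f' f(2) show False by (simp add: H_def)
    qed
    then have "f - clear v g = f' - g" using f'(2) g(2) by (auto simp: fun_eq_iff bit_neq_zero)
    moreover have "f' - g \<in> L" using f'(1) g(1) gf2.subspace_diff[OF L(1)] by simp
    moreover have "(f' - g) v = 0" using \<open>f' v \<noteq> 0\<close> g(2) by (simp add: bit_neq_zero)
    ultimately show ?thesis by (simp add: H_def)
  qed
  moreover have "finite I" using finite_supported_on[OF V(1)] I(2) by (rule rev_finite_subset)
  moreover have "clear v g \<in> I" using g(1) by (simp add: I_def)
  ultimately show "nullity (binary_matroid V I) = nullity (binary_matroid V H) + 1"
    unfolding nullity_def cycle_space_eq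
    using I(1) H(1) HI by (intro dim_hyperplane[of _ _ "clear v g"]) auto
qed

section \<open>The null space of the adjacency matrix\<close>

definition null_space :: "'a graph \<Rightarrow> ('a \<Rightarrow> bit) set" where
  "null_space G = {f \<in> supported_on (verts G).
     \<forall>w\<in>verts G. (\<Sum>s\<in>verts G. adj_matrix G w s * f s) = 0}"

lemma subspace_null_space: "gf2.subspace (null_space G)"
proof (rule gf2.subspaceI)
  fix f g c assume f: "f \<in> null_space G" and g: "g \<in> null_space G"
  then show "f + g \<in> null_space G"
    by (simp add: null_space_def supported_on_def distrib_left sum.distrib)
  have "(\<Sum>s\<in>verts G. adj_matrix G w s * (c * f s)) =
      c * (\<Sum>s\<in>verts G. adj_matrix G w s * f s)" for w
    by (simp add: sum_distrib_left mult.left_commute)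
  with f show "scale_bit c f \<in> null_space G"
    by (simp add: null_space_def supported_on_def scale_bit_def)
qed (simp add: null_space_def supported_on_def)

lemma adjacency_matroid_eq_binary_matroid:
  assumes "finite (verts G)"
  shows "adjacency_matroid G = binary_matroid (verts G) (null_space G)"
proof -
  have "minimal_nonempty_subsets (verts G) (columns_dependent G) =
    minimal_nonempty_subsets (verts G) (\<lambda>S. char_vec S \<in> null_space G)"
  proof (rule minimal_nonempty_subsets_cong)
    fix S assume S: "S \<subseteq> verts G" "columns_dependent G S"
    then obtain c where c: "\<exists>s\<in>S. c s \<noteq> 0"
      and z: "\<And>w. w \<in> verts G \<Longrightarrow> (\<Sum>s\<in>S. c s * adj_matrix G w s) = 0"
      by (auto simp: columns_dependent_def)
    define f where "f = (\<lambda>s. if s \<in> S then c s else 0)"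
    have "(\<Sum>s\<in>verts G. adj_matrix G w s * f s) = (\<Sum>s\<in>S. c s * adj_matrix G w s)" for w
      using S(1) assms by (intro sum.mono_neutral_cong_right) (auto simp: f_def)
    then have "f \<in> null_space G" using z S(1)
      by (auto simp: null_space_def supported_on_def f_def)
    moreover have "support f \<subseteq> S" by (auto simp: support_def f_def)
    moreover have "support f \<noteq> {}" using c by (auto simp: f_def fun_eq_iff)
    ultimately show "\<exists>T\<subseteq>S. T \<noteq> {} \<and> char_vec T \<in> null_space G"
      by (intro exI[of _ "support f"]) simp
  next
    fix S assume S: "S \<subseteq> verts G" "S \<noteq> {}" "char_vec S \<in> null_space G"
    have "(\<Sum>s\<in>S. char_vec S s * adj_matrix G w s) = (\<Sum>s\<in>verts G. adj_matrix G w s * char_vec S s)" for w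
      using S(1) assms by (intro sum.mono_neutral_cong_left) (auto simp: char_vec_def)
    then have "columns_dependent G S"
      unfolding columns_dependent_def using S
      by (intro exI[of _ "char_vec S"]) (auto simp: char_vec_def null_space_def)
    then show "\<exists>T\<subseteq>S. T \<noteq> {} \<and> columns_dependent G T" using S(2) by blast
  qed
  then show ?thesis by (simp add: adjacency_matroid_def binary_matroid_def)
qed

text \<open>
  In the notation of the introduction, for a vector with restriction \<open>x\<close> to \<open>W\<close>, this is the entry
  at \<open>w\<close> of $Ax$ if \<open>w \<noteq> v\<close>, and $b \cdot x$ if \<open>w = v\<close>. It ignores the entry at \<open>v\<close>, in which the
  six null spaces differ.
\<close>
definition row_sum :: "'a graph \<Rightarrow> 'a \<Rightarrow> ('a \<Rightarrow> bit) \<Rightarrow> 'a \<Rightarrow> bit" where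
  "row_sum G v f w = (\<Sum>s\<in>verts G - {v}. adj_matrix G w s * f s)"

lemma row_sum_upd [simp]: "row_sum G v (f(v := c)) = row_sum G v f"
  unfolding row_sum_def by (intro ext sum.cong) auto

lemma adj_matrix_sym: "adj_matrix G w s = adj_matrix G s w"
  by (simp add: adj_matrix_def adjacent_def insert_commute eq_commute[of w s])

lemma null_space_row_sum:
  assumes "finite (verts G)" "v \<in> verts G"
  shows "null_space G = {f \<in> supported_on (verts G).
    row_sum G v f v = adj_matrix G v v * f v \<and>
    (\<forall>w\<in>verts G - {v}. row_sum G v f w = adj_matrix G v w * f v)}"
proof -
  have "(\<Sum>s\<in>verts G. adj_matrix G w s * f s) = adj_matrix G v w * f v + row_sum G v f w" for f w
    unfolding row_sum_def adj_matrix_sym[of G v w] using assms by (rule sum.remove)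
  then have "(\<Sum>s\<in>verts G. adj_matrix G w s * f s) = 0 \<longleftrightarrow>
      row_sum G v f w = adj_matrix G v w * f v" for f w
    using bit_add_eq_0 by metis
  then show ?thesis using assms(2) by (auto simp: null_space_def)
qed

section \<open>Adjacency matrices of the six graphs\<close>

lemma verts_variants [simp]:
  "verts (unloop H v) = verts H" "verts (loop H v) = verts H"
  "verts (loop_isolate H v) = verts H" "verts (local_complement H v) = verts H"
  by (simp_all add: unloop_def loop_def loop_isolate_def local_complement_def)

lemma adj_matrix_unloop:
  "adj_matrix (unloop H v) a b = (if a = v \<and> b = v then 0 else adj_matrix H a b)"
  by (auto simp: adj_matrix_def unloop_def looped_def adjacent_def)

lemma adj_matrix_loop:
  "adj_matrix (loop H v) a b = (if a = v \<and> b = v then 1 else adj_matrix H a b)"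
  by (auto simp: adj_matrix_def loop_def unloop_def looped_def adjacent_def)

lemma adj_matrix_loop_isolate:
  "adj_matrix (loop_isolate H v) a b =
    (if a = v \<or> b = v then if a = b then 1 else 0 else adj_matrix H a b)"
  by (auto simp: adj_matrix_def loop_isolate_def loop_def unloop_def looped_def adjacent_def)

lemma set_mset_edges_local_complement:
  assumes "finite (verts G)"
  shows "set_mset (edges (local_complement G v)) =
    {{w} | w. w \<in> verts G \<and> looped G w \<noteq> adjacent G v w} \<union>
    {{w, x} | w x. w \<in> verts G \<and> x \<in> verts G \<and> w \<noteq> x \<and>
      adjacent G w x \<noteq> (adjacent G v w \<and> adjacent G v x)}" (is "_ = ?E")
proof -
  have "finite ?E" by (rule finite_subset[of _ "Pow (verts G)"]) (use assms in auto)
  then show ?thesis by (simp add: local_complement_def)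
qed

lemma looped_local_complement:
  assumes "finite (verts G)" "w \<in> verts G"
  shows "looped (local_complement G v) w \<longleftrightarrow> looped G w \<noteq> adjacent G v w"
  unfolding looped_def[of "local_complement G v"] set_mset_edges_local_complement[OF assms(1)]
  using assms(2) by auto

lemma adjacent_local_complement:
  assumes "finite (verts G)" "w \<in> verts G" "x \<in> verts G"
  shows "adjacent (local_complement G v) w x \<longleftrightarrow>
    w \<noteq> x \<and> adjacent G w x \<noteq> (adjacent G v w \<and> adjacent G v x)"
proof -
  have "adjacent G x w = adjacent G w x" by (auto simp: adjacent_def insert_commute)
  then show ?thesis
    unfolding adjacent_def[of "local_complement G v"] set_mset_edges_local_complement[OF assms(1)]
    using assms(2,3) by (auto simp: doubleton_eq_iff)
qed

lemma adj_matrix_local_complement: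
  assumes "finite (verts G)" "a \<in> verts G" "b \<in> verts G"
  shows "adj_matrix (local_complement G v) a b = adj_matrix G a b +
    (if a = v \<or> b = v then 0 else adj_matrix G v a * adj_matrix G v b)"
proof -
  have "\<not> adjacent G x x" for x by (simp add: adjacent_def)
  then show ?thesis
    using assms by (auto simp: adj_matrix_def looped_local_complement adjacent_local_complement)
qed

section \<open>The six null spaces\<close>

lemma row_sum_cong:
  assumes "verts H = verts G" "\<And>s. s \<in> verts G \<Longrightarrow> s \<noteq> v \<Longrightarrow> adj_matrix H w s = adj_matrix G w s"
  shows "row_sum H v f w = row_sum G v f w"
  unfolding row_sum_def assms(1) using assms(2) by (intro sum.cong) auto

text \<open>
  This is the passage from \<open>A\<close> to $A + bb^T$.
\<close>
lemma row_sum_local_complement: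
  assumes "finite (verts G)" "v \<in> verts G" "w \<in> verts G"
  shows "row_sum (local_complement G v) v f w =
    row_sum G v f w + (if w = v then 0 else adj_matrix G v w * row_sum G v f v)"
proof (cases "w = v")
  case True
  then show ?thesis using assms by (simp add: adj_matrix_local_complement cong: row_sum_cong)
next
  case False
  with assms show ?thesis
    by (simp add: row_sum_def adj_matrix_local_complement distrib_right sum.distrib
        sum_distrib_left mult.assoc)
qed

lemma null_space_unloop:
  assumes "finite (verts G)" "v \<in> verts G"
  shows "null_space (unloop G v) = {f \<in> supported_on (verts G). row_sum G v f v = 0 \<and>
    (\<forall>w\<in>verts G - {v}. row_sum G v f w = adj_matrix G v w * f v)}"
proof -
  have "row_sum (unloop G v) v f w = row_sum G v f w" for f w
    by (rule row_sum_cong) (simp_all add: adj_matrix_unloop)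
  then show ?thesis
    using assms by (simp add: null_space_row_sum[of _ v] adj_matrix_unloop)
qed

lemma null_space_loop:
  assumes "finite (verts G)" "v \<in> verts G"
  shows "null_space (loop G v) = {f \<in> supported_on (verts G). row_sum G v f v = f v \<and>
    (\<forall>w\<in>verts G - {v}. row_sum G v f w = adj_matrix G v w * f v)}"
proof -
  have "row_sum (loop G v) v f w = row_sum G v f w" for f w
    by (rule row_sum_cong) (simp_all add: adj_matrix_loop)
  then show ?thesis
    using assms by (simp add: null_space_row_sum[of _ v] adj_matrix_loop)
qed

lemma null_space_loop_isolate:
  assumes "finite (verts G)" "v \<in> verts G"
  shows "null_space (loop_isolate G v) = {f \<in> supported_on (verts G). f v = 0 \<and>
    (\<forall>w\<in>verts G - {v}. row_sum G v f w = 0)}"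
proof -
  have "row_sum (loop_isolate G v) v f w = row_sum G v f w" if "w \<noteq> v" for f w
    using that by (intro row_sum_cong) (simp_all add: adj_matrix_loop_isolate)
  moreover have "row_sum (loop_isolate G v) v f v = 0" for f
    unfolding row_sum_def by (rule sum.neutral) (auto simp: adj_matrix_loop_isolate)
  ultimately show ?thesis
    using assms by (auto simp: null_space_row_sum[of _ v] adj_matrix_loop_isolate)
qed

text \<open>
  Local complementation changes $Ax$ by $(b \cdot x) b$, which is zero when \<open>v\<close> is unlooped, as the
  equation at \<open>v\<close> then says $b \cdot x = 0$.
\<close>
lemma null_space_unloop_local_complement:
  assumes "finite (verts G)" "v \<in> verts G"
  shows "null_space (unloop (local_complement G v) v) = null_space (unloop G v)"
  using assms
  by (simp add: null_space_unloop row_sum_local_complement adj_matrix_local_complement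
      cong: conj_cong)

text \<open>
  The loop at \<open>v\<close> forces $t = b \cdot x$, so that the correction $(b \cdot x) b$ cancels the column
  of \<open>v\<close>.
\<close>
lemma null_space_loop_local_complement:
  assumes "finite (verts G)" "v \<in> verts G"
  shows "null_space (loop (local_complement G v) v) =
    {f \<in> supported_on (verts G). row_sum G v f v = f v \<and>
      (\<forall>w\<in>verts G - {v}. row_sum G v f w = 0)}"
  using assms
  by (simp add: null_space_loop row_sum_local_complement adj_matrix_local_complement
      cong: conj_cong)

text \<open>
  If the entry at \<open>v\<close> is prescribed by a function \<open>\<beta>\<close> of the other entries, then it carries no
  information: every vector with entry zero satisfying the remaining conditions has a unique lift.
\<close>
lemma clear_image:
  "clear v ` {f \<in> supported_on V. \<beta> f = f v \<and> P f} = {f \<in> supported_on V. f v = 0 \<and> P f}"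
  if "v \<in> V" "\<And>f c. \<beta> (f(v := c)) = \<beta> f" "\<And>f c. P (f(v := c)) = P f"
proof
  show "{f \<in> supported_on V. f v = 0 \<and> P f} \<subseteq> clear v ` {f \<in> supported_on V. \<beta> f = f v \<and> P f}"
  proof
    fix f assume "f \<in> {f \<in> supported_on V. f v = 0 \<and> P f}"
    then have f: "f \<in> supported_on V" "f v = 0" "P f" by auto
    have "f(v := \<beta> f) \<in> supported_on V" using f(1) that(1) by (simp add: supported_on_def)
    moreover have "f = clear v (f(v := \<beta> f))" using f(2) by (simp add: fun_eq_iff)
    ultimately show "f \<in> clear v ` {f \<in> supported_on V. \<beta> f = f v \<and> P f}"
      using f(3) that(2,3) by (intro image_eqI[of _ _ "f(v := \<beta> f)"]) simp_all
  qed
qed (auto simp: that supported_on_def)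

text \<open>
  The reason why contractions occur in the theorem: isolating \<open>v\<close> in one graph amounts to
  contracting \<open>v\<close> in the looped variant of the other.
\<close>
lemma null_space_loop_isolate_eq_clear:
  assumes "finite (verts G)" "v \<in> verts G"
  shows "null_space (loop_isolate G v) = clear v ` null_space (loop (local_complement G v) v)"
    and "null_space (loop_isolate (local_complement G v) v) = clear v ` null_space (loop G v)"
proof -
  show "null_space (loop_isolate G v) = clear v ` null_space (loop (local_complement G v) v)"
    using assms clear_image[of v "verts G" "\<lambda>f. row_sum G v f v"
        "\<lambda>f. \<forall>w\<in>verts G - {v}. row_sum G v f w = 0"]
    by (simp add: null_space_loop_isolate null_space_loop_local_complement)
  have "null_space (loop G v) = {f \<in> supported_on (verts G). row_sum G v f v = f v \<and>
    (\<forall>w\<in>verts G - {v}. row_sum G v f w = adj_matrix G v w * row_sum G v f v)}"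
    using assms by (simp add: null_space_loop cong: conj_cong)
  moreover have "null_space (loop_isolate (local_complement G v) v) =
    {f \<in> supported_on (verts G). f v = 0 \<and>
    (\<forall>w\<in>verts G - {v}. row_sum G v f w = adj_matrix G v w * row_sum G v f v)}"
    using assms by (simp add: null_space_loop_isolate row_sum_local_complement bit_add_eq_0)
  ultimately show "null_space (loop_isolate (local_complement G v) v) =
      clear v ` null_space (loop G v)"
    using assms clear_image[of v "verts G" "\<lambda>f. row_sum G v f v"
      "\<lambda>f. \<forall>w\<in>verts G - {v}. row_sum G v f w = adj_matrix G v w * row_sum G v f v"]
    by simp
qed

lemma null_spaces_agree_off_vertex:
  assumes "finite (verts G)" "v \<in> verts G"
  shows "{f \<in> null_space (loop G v). f v = 0} = {f \<in> null_space (unloop G v). f v = 0}"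
    and "{f \<in> null_space (loop (local_complement G v) v). f v = 0} =
      {f \<in> null_space (unloop G v). f v = 0}"
  unfolding null_space_loop_local_complement[OF assms] null_space_loop[OF assms]
    null_space_unloop[OF assms]
  by (auto simp del: bit_not_zero_iff)

lemma char_vec_singleton_notin_null_space_loop:
  assumes "finite (verts H)" "v \<in> verts H"
  shows "char_vec {v} \<notin> null_space (loop H v)"
proof -
  have "row_sum H v (char_vec {v}) v = 0"
    unfolding row_sum_def by (rule sum.neutral) (simp add: char_vec_def)
  then show ?thesis using assms by (simp add: null_space_loop) (simp add: char_vec_def)
qed

section \<open>Symmetry of the matrix\<close>

text \<open>
  This is $x^T A y = y^T A x$.
\<close>
lemma row_sum_pairing:
  "(\<Sum>w\<in>verts G - {v}. f w * row_sum G v g w) = (\<Sum>w\<in>verts G - {v}. g w * row_sum G v f w)"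
proof -
  have "(\<Sum>w\<in>verts G - {v}. f w * row_sum G v g w) =
      (\<Sum>w\<in>verts G - {v}. \<Sum>s\<in>verts G - {v}. f w * (adj_matrix G w s * g s))"
    by (simp add: row_sum_def sum_distrib_left)
  also have "\<dots> = (\<Sum>s\<in>verts G - {v}. \<Sum>w\<in>verts G - {v}. f w * (adj_matrix G w s * g s))"
    by (rule sum.swap)
  also have "\<dots> = (\<Sum>w\<in>verts G - {v}. g w * row_sum G v f w)"
    by (simp add: row_sum_def sum_distrib_left adj_matrix_sym[of G _ s for s] mult.commute
        mult.left_commute)
  finally show ?thesis .
qed

lemma pairing_with_neighbours:
  assumes "\<forall>w\<in>verts G - {v}. row_sum G v g w = adj_matrix G v w * d"
  shows "(\<Sum>w\<in>verts G - {v}. f w * row_sum G v g w) = d * row_sum G v f v"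
proof -
  have "(\<Sum>w\<in>verts G - {v}. f w * row_sum G v g w) =
      (\<Sum>w\<in>verts G - {v}. d * (adj_matrix G v w * f w))"
    using assms by (intro sum.cong) (simp_all add: mult_ac)
  then show ?thesis by (simp add: row_sum_def sum_distrib_left)
qed

text \<open>
  If $Ax = cb$ and $Ay = db$, then both sides are $x^T A y$.
\<close>
lemma row_sum_exchange:
  assumes "\<forall>w\<in>verts G - {v}. row_sum G v f w = adj_matrix G v w * c"
    and "\<forall>w\<in>verts G - {v}. row_sum G v g w = adj_matrix G v w * d"
  shows "d * row_sum G v f v = c * row_sum G v g v"
  using pairing_with_neighbours[OF assms(1), of g] pairing_with_neighbours[OF assms(2), of f]
    row_sum_pairing[of f G v g] by simp

text \<open>
  Off the diagonal, the terms cancel in symmetric pairs.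
\<close>
lemma sum_alternating_eq_0:
  fixes h :: "'a \<Rightarrow> 'a \<Rightarrow> bit"
  assumes "finite W" "\<And>w s. h w s = h s w" "\<And>w. w \<in> W \<Longrightarrow> h w w = 0"
  shows "(\<Sum>w\<in>W. \<Sum>s\<in>W. h w s) = 0"
  using assms(1,3)
proof (induction W rule: finite_induct)
  case (insert x W)
  have "(\<Sum>w\<in>W. h w x) = (\<Sum>w\<in>W. h x w)" using assms(2) by (intro sum.cong) auto
  with insert show ?case by (simp add: sum.distrib)
qed simp

lemma looped_vertex_if_noncoloop:
  assumes "finite (verts H)" "v \<in> verts H" "f \<in> null_space (loop H v)" "f v \<noteq> 0"
  shows "\<exists>w\<in>verts H - {v}. looped H w"
proof (rule ccontr)
  assume "\<not> ?thesis"
  then have "adj_matrix H w w = 0" if "w \<in> verts H - {v}" for w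
    using that by (auto simp: adj_matrix_def)
  then have "(\<Sum>w\<in>verts H - {v}. \<Sum>s\<in>verts H - {v}. f w * (adj_matrix H w s * f s)) = 0"
    using assms(1) adj_matrix_sym[of H]
    by (intro sum_alternating_eq_0) (auto simp: mult_ac)
  then have "(\<Sum>w\<in>verts H - {v}. f w * row_sum H v f w) = 0"
    by (simp add: row_sum_def sum_distrib_left)
  moreover have nb: "\<forall>w\<in>verts H - {v}. row_sum H v f w = adj_matrix H v w * f v"
    and "row_sum H v f v = f v"
    using assms by (auto simp: null_space_loop)
  ultimately have "f v * f v = 0" using pairing_with_neighbours[OF nb, of f] by simp
  with assms(4) show False by simp
qed

section \<open>Solvability of linear systems over GF(2)\<close>

lemma separating_functional:
  assumes S: "gf2.subspace S" and b: "b \<notin> S"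
  obtains g where "Vector_Spaces.linear scale_bit (*) g" "\<And>x. x \<in> S \<Longrightarrow> g x = 0" "g b = 1"
proof -
  interpret bit: vector_space "(*) :: bit \<Rightarrow> bit \<Rightarrow> bit"
    by unfold_locales (simp_all add: algebra_simps)
  interpret vector_space_pair scale_bit "(*) :: bit \<Rightarrow> bit \<Rightarrow> bit" ..
  obtain B where B: "B \<subseteq> S" "gf2.independent B" "S \<subseteq> gf2.span B"
    by (rule gf2.basis_exists)
  have sp: "gf2.span B = S" using gf2.span_minimal[OF B(1) S] B(3) by (rule subset_antisym)
  have nb: "b \<notin> B" using B(1) b by blast
  have indep: "gf2.independent (insert b B)"
    using B(2) b nb gf2.independent_insert[of b B] unfolding sp by simp
  obtain g where g: "Vector_Spaces.linear scale_bit (*) g"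
    and eq: "\<forall>x\<in>insert b B. g x = (if x = b then 1 else 0)"
    using linear_independent_extend[OF indep, of "\<lambda>x. if x = b then 1 else 0"] by blast
  have "g x = 0" if "x \<in> S" for x
  proof (rule linear_eq_0_on_span[OF g])
    show "x \<in> gf2.span B" using that sp by simp
  qed (use eq nb in auto)
  then show ?thesis using that g eq by simp
qed

text \<open>
  The Fredholm alternative. A functional that separates \<open>b\<close> from the column space of \<open>a\<close> is the
  product with a vector \<open>f\<close>, whose entries are the values of the functional at unit vectors. Such
  an \<open>f\<close> annihilates all columns of \<open>a\<close> but not \<open>b\<close>.
\<close>
lemma linear_system_solvable:
  fixes a :: "'a \<Rightarrow> 'a \<Rightarrow> bit"
  assumes W: "finite W"
    and ann: "\<And>f. f \<in> supported_on W \<Longrightarrow> (\<forall>s\<in>W. (\<Sum>w\<in>W. f w * a w s) = 0) \<Longrightarrow>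
      (\<Sum>w\<in>W. f w * b w) = 0"
  shows "\<exists>x\<in>supported_on W. \<forall>w\<in>W. (\<Sum>s\<in>W. a w s * x s) = b w"
proof (rule ccontr)
  assume unsolvable: "\<not> ?thesis"
  \<comment> \<open>Vectors are cut off outside \<open>W\<close>, since equality of functions also sees the values there.\<close>
  define restr where "restr h = (\<lambda>w. if w \<in> W then h w else 0)" for h :: "'a \<Rightarrow> bit"
  define apply_a where "apply_a x = restr (\<lambda>w. \<Sum>s\<in>W. a w s * x s)" for x
  have "gf2.subspace (apply_a ` supported_on W)"
  proof (rule gf2.subspaceI)
    have "apply_a 0 = 0" by (simp add: apply_a_def restr_def fun_eq_iff)
    then show "0 \<in> apply_a ` supported_on W"
      by (intro image_eqI[of _ _ 0]) (simp_all add: supported_on_def)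
  next
    fix x y assume "x \<in> apply_a ` supported_on W" "y \<in> apply_a ` supported_on W"
    then obtain x' y' where "x = apply_a x'" "y = apply_a y'"
      "x' \<in> supported_on W" "y' \<in> supported_on W" by blast
    then show "x + y \<in> apply_a ` supported_on W"
      by (intro image_eqI[of _ _ "x' + y'"])
        (auto simp: apply_a_def restr_def supported_on_def distrib_left sum.distrib)
  next
    fix c x assume "x \<in> apply_a ` supported_on W"
    then obtain x' where "x = apply_a x'" "x' \<in> supported_on W" by blast
    then show "scale_bit c x \<in> apply_a ` supported_on W"
      by (intro image_eqI[of _ _ "scale_bit c x'"])
        (auto simp: apply_a_def restr_def supported_on_def scale_bit_def sum_distrib_left mult_ac)
  qed
  moreover have "restr b \<notin> apply_a ` supported_on W"
  proof
    assume "restr b \<in> apply_a ` supported_on W"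
    then obtain x where x: "x \<in> supported_on W" "restr b = apply_a x" by blast
    have "(\<Sum>s\<in>W. a w s * x s) = b w" if "w \<in> W" for w
      using fun_cong[OF x(2), of w] that by (simp add: apply_a_def restr_def)
    with x(1) unsolvable show False by blast
  qed
  ultimately obtain g where g: "Vector_Spaces.linear scale_bit (*) g"
    and g0: "\<And>h. h \<in> apply_a ` supported_on W \<Longrightarrow> g h = 0" and g1: "g (restr b) = 1"
    by (rule separating_functional) blast
  interpret g: Vector_Spaces.linear scale_bit "(*)" g by (fact g)
  define f where "f w = (if w \<in> W then g (char_vec {w}) else 0)" for w
  have g_restr: "g (restr h) = (\<Sum>w\<in>W. f w * h w)" for h
  proof -
    have "restr h = (\<Sum>w\<in>W. scale_bit (h w) (char_vec {w}))"
    proof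
      fix x
      have "(\<Sum>w\<in>W. scale_bit (h w) (char_vec {w})) x = (\<Sum>w\<in>W. if w = x then h w else 0)"
        using W by (induction W rule: finite_induct) (auto simp: scale_bit_def char_vec_def)
      then show "restr h x = (\<Sum>w\<in>W. scale_bit (h w) (char_vec {w})) x"
        using W by (simp add: restr_def)
    qed
    then have "g (restr h) = (\<Sum>w\<in>W. h w * g (char_vec {w}))"
      by (simp add: g.sum g.scale)
    then show ?thesis by (simp add: f_def mult.commute)
  qed
  have "(\<Sum>w\<in>W. f w * a w s) = 0" if s: "s \<in> W" for s
  proof -
    have "char_vec {s} \<in> supported_on W" using s by (simp add: supported_on_def char_vec_def)
    moreover have "apply_a (char_vec {s}) = restr (\<lambda>w. a w s)"
      using W s by (auto simp: apply_a_def restr_def char_vec_def fun_eq_iff if_distrib cong: if_cong)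
    ultimately have "g (restr (\<lambda>w. a w s)) = 0" using g0 by (metis imageI)
    then show ?thesis by (simp only: g_restr)
  qed
  moreover have "f \<in> supported_on W" by (simp add: supported_on_def f_def)
  ultimately have "(\<Sum>w\<in>W. f w * b w) = 0" using ann by blast
  with g1 show False by (simp add: g_restr)
qed

section \<open>Exactly one matroid in which the vertex is not a coloop\<close>

text \<open>
  Since \<open>A\<close> is symmetric, a vector that annihilates its columns is a solution of $Ay = 0$; so, if
  \<open>v\<close> is a coloop for $G^v(v,\ell)$, then $Ax = b$ has a solution. It extends by $t = 1$ to a vector
  for $G(v)$ or for $G(v,\ell)$, depending on $b \cdot x$.
\<close>
lemma exists_noncoloop_vector:
  assumes fin: "finite (verts G)" and v: "v \<in> verts G"
    and coloop: "\<And>f. f \<in> null_space (loop (local_complement G v) v) \<Longrightarrow> f v = 0"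
  shows "(\<exists>f\<in>null_space (unloop G v). f v \<noteq> 0) \<or> (\<exists>f\<in>null_space (loop G v). f v \<noteq> 0)"
proof -
  let ?W = "verts G - {v}"
  have "(\<Sum>w\<in>?W. f w * adj_matrix G v w) = 0"
    if f: "f \<in> supported_on ?W" "\<forall>s\<in>?W. (\<Sum>w\<in>?W. f w * adj_matrix G w s) = 0" for f
  proof -
    have "\<forall>s\<in>?W. row_sum G v f s = 0"
      using f(2) by (simp add: row_sum_def adj_matrix_sym[of G _ s for s] mult.commute)
    then have "f(v := row_sum G v f v) \<in> null_space (loop (local_complement G v) v)"
      unfolding null_space_loop_local_complement[OF fin v] using f(1) v
      by (simp add: supported_on_def)
    then have "row_sum G v f v = 0" using coloop by fastforce
    then show ?thesis by (simp add: row_sum_def mult.commute)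
  qed
  then obtain x where x: "x \<in> supported_on ?W"
    "\<forall>w\<in>?W. (\<Sum>s\<in>?W. adj_matrix G w s * x s) = adj_matrix G v w"
    using linear_system_solvable[of ?W "adj_matrix G" "adj_matrix G v"] fin by blast
  let ?f = "x(v := 1)"
  have f: "?f \<in> supported_on (verts G)" "\<forall>w\<in>?W. row_sum G v ?f w = adj_matrix G v w * ?f v"
    using x v by (simp_all add: supported_on_def row_sum_def[of G v x])
  show ?thesis
  proof (cases "row_sum G v ?f v = 0")
    case True
    then have "?f \<in> null_space (unloop G v)" using f by (simp add: null_space_unloop[OF fin v])
    then show ?thesis by (intro disjI1 bexI) simp_all
  next
    case False
    then have "?f \<in> null_space (loop G v)"
      using f by (simp add: null_space_loop[OF fin v] bit_neq_zero)
    then show ?thesis by (intro disjI2 bexI) simp_all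
  qed
qed

lemma at_most_one_noncoloop:
  assumes fin: "finite (verts G)" and v: "v \<in> verts G"
  defines "A \<equiv> null_space (unloop G v)" and "B \<equiv> null_space (loop G v)"
    and "C \<equiv> null_space (loop (local_complement G v) v)"
  shows "\<lbrakk>f \<in> A; g \<in> B\<rbrakk> \<Longrightarrow> f v = 0 \<or> g v = 0"
    and "\<lbrakk>f \<in> A; g \<in> C\<rbrakk> \<Longrightarrow> f v = 0 \<or> g v = 0"
    and "\<lbrakk>f \<in> B; g \<in> C\<rbrakk> \<Longrightarrow> f v = 0 \<or> g v = 0"
proof -
  note defs = A_def B_def C_def null_space_unloop[OF fin v] null_space_loop[OF fin v]
    null_space_loop_local_complement[OF fin v]
  show "f v = 0 \<or> g v = 0" if "f \<in> A" "g \<in> B"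
    using that row_sum_exchange[of G v f "f v" g "g v"] unfolding defs by auto
  show "f v = 0 \<or> g v = 0" if "f \<in> A" "g \<in> C"
    using that row_sum_exchange[of G v f "f v" g 0] unfolding defs by auto
  show "f v = 0 \<or> g v = 0" if "f \<in> B" "g \<in> C"
    using that row_sum_exchange[of G v f "f v" g 0] unfolding defs by auto
qed

text \<open>
  In the proof, \<open>A\<close>, \<open>B\<close> and \<open>C\<close> are the null spaces for $G(v)$, $G(v,\ell)$ and $G^v(v,\ell)$. In
  each case two of them collapse to \<open>H\<close>, and clearing the entry at \<open>v\<close> fixes \<open>H\<close>, so every matroid
  in the list is given by \<open>H\<close>, by the exceptional space, or by its image under \<open>clear v\<close>.
\<close>
theorem theorem23:
  fixes G :: "'a graph" and v :: 'a
  assumes "graph G" and "v \<in> verts G"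
  shows
   "let G' = local_complement G v;
        M = adjacency_matroid (unloop G v);
        M\<^sub>l = adjacency_matroid (loop G v);
        M\<^sub>l\<^sub>i = adjacency_matroid (loop_isolate G v);
        N = adjacency_matroid (unloop G' v);
        N\<^sub>l = adjacency_matroid (loop G' v);
        N\<^sub>l\<^sub>i = adjacency_matroid (loop_isolate G' v);
        L = {M, M\<^sub>l, M\<^sub>l\<^sub>i, N, N\<^sub>l, N\<^sub>l\<^sub>i}
    in (card L = 2 \<or> card L = 3) \<and>
       (\<exists>!K. K \<in> L \<and> \<not> coloop K v) \<and>
       (coloop M v \<and> coloop M\<^sub>l v \<longrightarrow>
          \<not> coloop N\<^sub>l v \<and>
          M\<^sub>l\<^sub>i = contract N\<^sub>l v \<oplus> U11 v \<and>
          M = M\<^sub>l \<and> M\<^sub>l = N \<and> N = N\<^sub>l\<^sub>i \<and> N\<^sub>l\<^sub>i = delete N\<^sub>l v \<oplus> U11 v \<and>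
          (\<exists>\<nu>. nullity M\<^sub>l\<^sub>i = \<nu> + 1 \<and> nullity N\<^sub>l = \<nu> + 1 \<and> nullity M = \<nu>) \<and>
          cycle_space M\<^sub>l\<^sub>i \<inter> cycle_space N\<^sub>l = cycle_space M \<and>
          (\<exists>w\<in>verts (delete_vertex G' v). looped (delete_vertex G' v) w)) \<and>
       (\<not> coloop M\<^sub>l v \<longrightarrow>
          N\<^sub>l\<^sub>i = contract M\<^sub>l v \<oplus> U11 v \<and>
          N = N\<^sub>l \<and> N\<^sub>l = M \<and> M = M\<^sub>l\<^sub>i \<and> M\<^sub>l\<^sub>i = delete M\<^sub>l v \<oplus> U11 v \<and>
          (\<exists>\<nu>. nullity N\<^sub>l\<^sub>i = \<nu> + 1 \<and> nullity M\<^sub>l = \<nu> + 1 \<and> nullity N = \<nu>) \<and>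
          cycle_space N\<^sub>l\<^sub>i \<inter> cycle_space M\<^sub>l = cycle_space N \<and>
          (\<exists>w\<in>verts (delete_vertex G v). looped (delete_vertex G v) w)) \<and>
       (\<not> coloop M v \<longrightarrow>
          N = M \<and>
          M\<^sub>l = N\<^sub>l \<and> N\<^sub>l = M\<^sub>l\<^sub>i \<and> M\<^sub>l\<^sub>i = N\<^sub>l\<^sub>i \<and> N\<^sub>l\<^sub>i = delete M v \<oplus> U11 v \<and>
          nullity M = nullity M\<^sub>l + 1 \<and>
          cycle_space M\<^sub>l \<subset> cycle_space M)"
proof -
  let ?V = "verts G" and ?G' = "local_complement G v"
  have fin: "finite ?V" and v: "v \<in> ?V" using assms by (auto simp: graph_def)
  define A where "A = null_space (unloop G v)"
  define B where "B = null_space (loop G v)"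
  define C where "C = null_space (loop ?G' v)"
  define H where "H = {f \<in> A. f v = 0}"
  have sub: "gf2.subspace A" "gf2.subspace B" "gf2.subspace C"
    by (simp_all add: A_def B_def C_def subspace_null_space)
  have supp: "A \<subseteq> supported_on ?V" "B \<subseteq> supported_on ?V" "C \<subseteq> supported_on ?V"
    by (auto simp: A_def B_def C_def null_space_def)
  have H_eq: "{f \<in> A. f v = 0} = H" "{f \<in> B. f v = 0} = H" "{f \<in> C. f v = 0} = H"
    using null_spaces_agree_off_vertex[OF fin v] by (simp_all add: A_def B_def C_def H_def)
  have nl: "char_vec {v} \<notin> B" "char_vec {v} \<notin> C"
    using char_vec_singleton_notin_null_space_loop[of G v]
      char_vec_singleton_notin_null_space_loop[of ?G' v] fin v by (simp_all add: B_def C_def)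
  have matroids:
    "adjacency_matroid (unloop G v) = binary_matroid ?V A"
    "adjacency_matroid (loop G v) = binary_matroid ?V B"
    "adjacency_matroid (loop_isolate G v) = binary_matroid ?V (clear v ` C)"
    "adjacency_matroid (unloop ?G' v) = binary_matroid ?V A"
    "adjacency_matroid (loop ?G' v) = binary_matroid ?V C"
    "adjacency_matroid (loop_isolate ?G' v) = binary_matroid ?V (clear v ` B)"
    using fin by (simp_all add: adjacency_matroid_eq_binary_matroid A_def B_def C_def
      null_space_unloop_local_complement[OF fin v] null_space_loop_isolate_eq_clear[OF fin v])
  have looped: "\<exists>w\<in>verts (delete_vertex K v). looped (delete_vertex K v) w"
    if "f \<in> null_space (loop K v)" "f v \<noteq> 0" "verts K = ?V" for K f
    using looped_vertex_if_noncoloop[of K v f] that fin v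
    by (auto simp: delete_vertex_def looped_def)
  have clear_H: "clear v ` H = H"
    by (auto simp: H_def fun_upd_idem intro!: image_eqI[of _ "clear v"])
  have all_zero: "X = H" if "{f \<in> X. f v = 0} = H" "\<And>f. f \<in> X \<Longrightarrow> f v = 0" for X
    using that by blast
  note excl = at_most_one_noncoloop[OF fin v, folded A_def B_def C_def]
  consider (C) "\<exists>g\<in>C. g v \<noteq> 0" | (A) "\<exists>g\<in>A. g v \<noteq> 0" | (B) "\<exists>g\<in>B. g v \<noteq> 0"
    using exists_noncoloop_vector[OF fin v] unfolding A_def B_def C_def by blast
  then show ?thesis
  proof cases
    case C
    then obtain g where g: "g \<in> C" "g v \<noteq> 0" by blast
    have eq: "A = H" "B = H"
      using all_zero[OF H_eq(1)] all_zero[OF H_eq(2)] excl(2,3) g by blast+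
    note * = noncoloop_matroid[OF fin v sub(3) supp(3) g, unfolded H_eq]
      noncoloop_matroid_contract[OF fin v sub(3) supp(3) g nl(2), unfolded H_eq]
    have loops: "\<exists>w\<in>verts (delete_vertex ?G' v). looped (delete_vertex ?G' v) w"
      using looped[of g ?G'] g by (simp add: C_def)
    \<comment> \<open>Both have \<open>v\<close> as a coloop; only the nullities tell them apart.\<close>
    have "binary_matroid ?V H \<noteq> binary_matroid ?V (clear v ` C)" using *(8) by auto
    moreover have "binary_matroid ?V C \<notin> {binary_matroid ?V H, binary_matroid ?V (clear v ` C)}"
      using *(1,2,6) by auto
    ultimately show ?thesis
      unfolding Let_def matroids eq clear_H
      using * loops by (auto simp: card_insert_if)
  next
    case B
    then obtain g where g: "g \<in> B" "g v \<noteq> 0" by blast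
    have eq: "A = H" "C = H"
      using all_zero[OF H_eq(1)] all_zero[OF H_eq(3)] excl(1,3) g by blast+
    note * = noncoloop_matroid[OF fin v sub(2) supp(2) g, unfolded H_eq]
      noncoloop_matroid_contract[OF fin v sub(2) supp(2) g nl(1), unfolded H_eq]
    have loops: "\<exists>w\<in>verts (delete_vertex G v). looped (delete_vertex G v) w"
      using looped[of g G] g by (simp add: B_def)
    have "binary_matroid ?V H \<noteq> binary_matroid ?V (clear v ` B)" using *(8) by auto
    moreover have "binary_matroid ?V B \<notin> {binary_matroid ?V H, binary_matroid ?V (clear v ` B)}"
      using *(1,2,6) by auto
    ultimately show ?thesis
      unfolding Let_def matroids eq clear_H
      using * loops by (auto simp: card_insert_if)
  next
    case A
    then obtain g where g: "g \<in> A" "g v \<noteq> 0" by blast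
    have eq: "B = H" "C = H"
      using all_zero[OF H_eq(2)] all_zero[OF H_eq(3)] excl(1,2) g by blast+
    note * = noncoloop_matroid[OF fin v sub(1) supp(1) g, unfolded H_eq]
    have "binary_matroid ?V A \<noteq> binary_matroid ?V H" using *(1,2) by auto
    then show ?thesis
      unfolding Let_def matroids eq clear_H
      using * by (auto simp: card_insert_if)
  qed
qed

end
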